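(* Let $\lambda$ be a nonzero real number. For any positive integers $r$ and $n$ and any functions $f_{1},f_{2},\dots,f_{n}:\mathbb{R}\to\mathbb{C}$, $$\delta_{\lambda}^{r}(f_{1}f_{2}\cdots f_{n})=\frac{1}{\lambda^{r}}\sum_{k=0}^{r}\binom{r}{k}(-1)^{r-k}L_{\lambda}^{k}(f_{1})L_{\lambda}^{k}(f_{2})\cdots L_{\lambda}^{k}(f_{n})$$ as functions on $\mathbb{R}$, where, for every $i=1,2,\dots,n$ and every $0\le k\le r$, $$L_{\lambda}^{k}(f_{i})=(I+\lambda\delta_{\lambda})^{k}(f_{i})=\sum_{j_{i}=0}^{k}\binom{k}{j_{i}}\lambda^{j_{i}}\delta_{\lambda}^{j_{i}}f_{i}.$$
   Context: For a nonzero real number $\lambda$ and a function $f:\mathbb{R}\to\mathbb{C}$, the difference quotient of $f$ is the function $\delta_{\lambda}f:\mathbb{R}\to\mathbb{C}$ given by $(\delta_{\lambda}f)(x)=\frac{f(x+\lambda)-f(x)}{\lambda}$. The operator $L_{\lambda}$ on complex-valued functions on $\mathbb{R}$ is defined by $L_{\lambda}=I+\lambda\delta_{\lambda}$, where $I$ is the identity operator. For a nonnegative integer $m$, $\delta_{\lambda}^{m}$ and $L_{\lambda}^{m}$ denote $m$-fold iterates (composition powers) of these operators, with zeroth power the identity. Products of functions are pointwise. *)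

theory Defs
  imports Complex_Main
begin

definition diff_quot :: "real \<Rightarrow> (real \<Rightarrow> complex) \<Rightarrow> real \<Rightarrow> complex"
  where "diff_quot lam f = (\<lambda>x. (f (x + lam) - f x) / of_real lam)"

(* The operator I + lam * diff_quot lam; its iterates are compositional powers (^^). *)
definition L_op :: "real \<Rightarrow> (real \<Rightarrow> complex) \<Rightarrow> real \<Rightarrow> complex"
  where "L_op lam f = (\<lambda>x. f x + of_real lam * diff_quot lam f x)"

end

theory Submission
  imports Defs
begin

text \<open>
  For nonzero \<open>lam\<close> the operator \<open>L_op lam\<close> is the shift by \<open>lam\<close>, hence multiplicative, and
  \<open>lam * diff_quot lam\<close> is the shift minus the identity. Both identities are therefore binomial
  expansions, of \<open>(L - I)^r\<close> and of \<open>(I + lam * diff_quot lam)^k\<close> respectively.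
\<close>

text \<open>Pascal's rule in summed form, with \<open>h\<close> arbitrary so that it serves as the
  induction step of both expansions below.\<close>

lemma sum_binomial_Suc:
  fixes h :: "nat \<Rightarrow> 'a::comm_semiring_1"
  shows "(\<Sum>j=0..Suc k. of_nat (Suc k choose j) * h j) =
           (\<Sum>j=0..k. of_nat (k choose j) * (h j + h (Suc j)))"
proof -
  \<comment> \<open>The added term has coefficient \<open>k choose Suc k\<close>, which is 0.
    Splitting off index 0 then aligns this sum with the one over \<open>h (Suc j)\<close>.\<close>
  have "(\<Sum>j=0..k. of_nat (k choose j) * h j) = (\<Sum>j=0..Suc k. of_nat (k choose j) * h j)"
    by (simp add: binomial_eq_0)
  also have "\<dots> = h 0 + (\<Sum>j=0..k. of_nat (k choose Suc j) * h (Suc j))"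
    by (simp only: sum.atLeast0_atMost_Suc_shift) simp
  finally show ?thesis
    by (simp only: sum.atLeast0_atMost_Suc_shift) (simp add: algebra_simps sum.distrib)
qed

lemma L_op_eq_shift: "lam \<noteq> 0 \<Longrightarrow> L_op lam f x = f (x + lam)"
  by (simp add: L_op_def diff_quot_def)

lemma funpow_L_op_eq_shift: "lam \<noteq> 0 \<Longrightarrow> (L_op lam ^^ k) f x = f (x + of_nat k * lam)"
  by (induction k arbitrary: x) (simp_all add: L_op_eq_shift algebra_simps)

text \<open>Induction on \<open>r\<close> with \<open>x\<close> arbitrary: the outermost
  \<open>diff_quot\<close> takes the difference of the induction hypothesis at
  \<open>x + lam\<close> and at \<open>x\<close>.\<close>

lemma funpow_diff_quot:
  assumes "lam \<noteq> 0"
  shows "(diff_quot lam ^^ r) f x =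
    1 / of_real lam ^ r * (\<Sum>k=0..r. of_nat (r choose k) * ((- 1) ^ (r - k) * f (x + of_nat k * lam)))"
proof (induction r arbitrary: x)
  case (Suc r)
  \<comment> \<open>The sign exponent is that of the case \<open>Suc r\<close>. Passing from
    \<open>k\<close> to \<open>Suc k\<close> shifts the argument by \<open>lam\<close> and flips the
    sign; since subtraction is truncated, \<open>Suc r - k = Suc (r - k)\<close> requires
    \<open>k\<close> in \<open>{0..r}\<close>.\<close>
  let ?h = "\<lambda>k. (- 1) ^ (Suc r - k) * f (x + of_nat k * lam)"
  have h: "?h k + ?h (Suc k) =
      (- 1) ^ (r - k) * f (x + lam + of_nat k * lam) - (- 1) ^ (r - k) * f (x + of_nat k * lam)"
    if "k \<in> {0..r}" for k
    using that by (simp add: Suc_diff_le algebra_simps)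
  have "(diff_quot lam ^^ Suc r) f x = 1 / of_real lam ^ Suc r *
      ((\<Sum>k=0..r. of_nat (r choose k) * ((- 1) ^ (r - k) * f (x + lam + of_nat k * lam))) -
       (\<Sum>k=0..r. of_nat (r choose k) * ((- 1) ^ (r - k) * f (x + of_nat k * lam))))"
    using assms by (simp add: diff_quot_def Suc.IH field_simps)
  also have "\<dots> = 1 / of_real lam ^ Suc r *
      (\<Sum>k=0..r. of_nat (r choose k) * (?h k + ?h (Suc k)))"
    by (simp only: h right_diff_distrib sum_subtractf cong: sum.cong)
  finally show ?case
    by (simp only: sum_binomial_Suc)
qed simp

lemma funpow_L_op_eq_sum_diff_quot:
  assumes "lam \<noteq> 0"
  shows "(L_op lam ^^ k) f x =
    (\<Sum>j=0..k. of_nat (k choose j) * (of_real lam ^ j * (diff_quot lam ^^ j) f x))"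
proof (induction k arbitrary: x)
  case (Suc k)
  have shift: "g (x + lam) = g x + of_real lam * diff_quot lam g x" for g
    using assms by (simp add: diff_quot_def)
  have "(L_op lam ^^ Suc k) f x = (L_op lam ^^ k) f (x + lam)"
    using assms by (simp add: L_op_eq_shift)
  also have "\<dots> = (\<Sum>j=0..k. of_nat (k choose j) *
      (of_real lam ^ j * (diff_quot lam ^^ j) f x
       + of_real lam ^ Suc j * (diff_quot lam ^^ Suc j) f x))"
    \<comment> \<open>The induction hypothesis is used at \<open>x + lam\<close>; then
      \<open>shift\<close>, with \<open>g\<close> the \<open>j\<close>-th iterated difference
      quotient, splits each term into those of index \<open>j\<close> and
      \<open>Suc j\<close>.\<close>
    by (simp only: Suc.IH, simp only: shift) (simp add: algebra_simps)
  finally show ?case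
    by (simp only: sum_binomial_Suc)
qed simp

theorem theorem1p3:
  fixes lam :: real and r n :: nat and f :: "nat \<Rightarrow> real \<Rightarrow> complex"
  assumes "lam \<noteq> 0" and "r \<ge> 1" and "n \<ge> 1"
  shows "(diff_quot lam ^^ r) (\<lambda>x. \<Prod>i=1..n. f i x) =
           (\<lambda>x. 1 / of_real lam ^ r *
             (\<Sum>k=0..r. of_nat (r choose k) * (- 1) ^ (r - k) *
               (\<Prod>i=1..n. (L_op lam ^^ k) (f i) x)))
       \<and> (\<forall>i\<in>{1..n}. \<forall>k\<in>{0..r}.
            (L_op lam ^^ k) (f i) =
              ((\<lambda>g x. g x + of_real lam * diff_quot lam g x) ^^ k) (f i)
          \<and> ((\<lambda>g x. g x + of_real lam * diff_quot lam g x) ^^ k) (f i) =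
              (\<lambda>x. \<Sum>j=0..k. of_nat (k choose j) * of_real lam ^ j *
                 (diff_quot lam ^^ j) (f i) x))"
proof -
  have L_op: "(\<lambda>g x. g x + of_real lam * diff_quot lam g x) = L_op lam"
    by (simp add: L_op_def fun_eq_iff)
  show ?thesis
    unfolding L_op
  proof (intro conjI ballI ext refl)
    fix x
    show "(diff_quot lam ^^ r) (\<lambda>x. \<Prod>i=1..n. f i x) x =
        1 / of_real lam ^ r * (\<Sum>k=0..r. of_nat (r choose k) * (- 1) ^ (r - k) *
          (\<Prod>i=1..n. (L_op lam ^^ k) (f i) x))"
      \<comment> \<open>The expansion is applied to the whole product: its value at
        \<open>x + of_nat k * lam\<close> is, factor by factor, the product of the
        \<open>(L_op lam ^^ k) (f i) x\<close>.\<close>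
      using assms(1) by (simp only: funpow_diff_quot funpow_L_op_eq_shift mult.assoc not_False_eq_True)
  next
    fix i k x
    show "(L_op lam ^^ k) (f i) x = (\<Sum>j=0..k. of_nat (k choose j) * of_real lam ^ j *
        (diff_quot lam ^^ j) (f i) x)"
      by (simp only: funpow_L_op_eq_sum_diff_quot[OF assms(1)] mult.assoc)
  qed
qed

end
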